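(* Let $\alpha,\beta\ge 1$. For the problem of scheduling with uncertain processing times on a single machine with the objective of minimizing the total completion time, the competitive ratio of the algorithm $(\alpha,\beta)$-PCP is at most $$\max\left\{\alpha\left(1+\tfrac1\beta\right),\ 1+\tfrac1\alpha+\tfrac1\beta+\tfrac1{\alpha\beta},\ \beta,\ 2,\ 1+\tfrac2\alpha\right\}.$$
   Context: Problem. There are $n$ jobs, all available at time $0$. Job $j$ has a testing time $t_j\ge 0$, an upper limit $u_j\ge 0$, and a real processing time $p_j\in[0,u_j]$. A job may be executed untested, which takes $u_j$ time units, or it may be tested (taking $t_j$ time units) and later executed in $p_j$ time units; other tasks may run between the test and the execution. A single machine runs one task at a time. The completion time of a job is the time at which its execution (or execution-untested) ends, and the cost of a schedule is the sum of the completion times of all jobs. An online algorithm knows all $t_j,u_j$ from the start, but learns $p_j$ only when the test of $j$ is finished. $\mathrm{OPT}$ knows all $p_j$ in advance (but must still test $j$ in order to run it in time $p_j$), and its cost is the minimum cost of any schedule; it spends $p_j^*=\min\{u_j,t_j+p_j\}$ on job $j$ and runs jobs in non-decreasing order of $p_j^*$. The competitive ratio of an online algorithm $A$ is the smallest $c$ such that $\mathrm{cost}(A)\le c\cdot \mathrm{cost}(\mathrm{OPT})$ on all instances. Algorithm $(\alpha,\beta)$-PCP (Prioritizing-Certain-Processing-time). Maintain a priority queue of tasks, smaller weight meaning higher priority (ties broken arbitrarily). Initially, for each job $j$: if $u_j\ge\alpha t_j$, insert a testing task of weight $\beta t_j$; otherwise insert an execution-untested task of weight $u_j$. While the queue is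 nonempty, extract a task of smallest weight and run it; if it was the testing task of job $j$, then after the test insert an execution task for $j$ with weight $t_j+p_j$ (running this execution task takes $p_j$ time). *)

theory Defs
  imports "HOL-Library.Extended_Real"
begin

record instance_data =
  num_jobs :: nat
  test_time :: "nat \<Rightarrow> real"
  upper_limit :: "nat \<Rightarrow> real"
  proc_time :: "nat \<Rightarrow> real"

definition valid_instance :: "instance_data \<Rightarrow> bool" where
  "valid_instance I \<longleftrightarrow>
     (\<forall>j < num_jobs I. 0 \<le> test_time I j \<and> 0 \<le> upper_limit I j \<and>
        0 \<le> proc_time I j \<and> proc_time I j \<le> upper_limit I j)"

datatype task = Test nat | Exec_Tested nat | Exec_Untested nat

fun job_of :: "task \<Rightarrow> nat" where
  "job_of (Test j) = j"
| "job_of (Exec_Tested j) = j"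
| "job_of (Exec_Untested j) = j"

fun duration :: "instance_data \<Rightarrow> task \<Rightarrow> real" where
  "duration I (Test j) = test_time I j"
| "duration I (Exec_Tested j) = proc_time I j"
| "duration I (Exec_Untested j) = upper_limit I j"

text \<open>A schedule lists its tasks, paired with their start times, in the order in which the
  machine runs them. The machine may idle between two tasks.\<close>

type_synonym schedule = "(real \<times> task) list"

fun sequential_from :: "instance_data \<Rightarrow> real \<Rightarrow> schedule \<Rightarrow> bool" where
  "sequential_from I \<tau> [] \<longleftrightarrow> True"
| "sequential_from I \<tau> ((s, k) # S) \<longleftrightarrow> \<tau> \<le> s \<and> sequential_from I (s + duration I k) S"

definition runs_untested :: "schedule \<Rightarrow> nat \<Rightarrow> bool" where
  "runs_untested S j \<longleftrightarrow>
     Exec_Untested j \<in> snd ` set S \<and> Test j \<notin> snd ` set S \<and> Exec_Tested j \<notin> snd ` set S"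

definition runs_tested :: "instance_data \<Rightarrow> schedule \<Rightarrow> nat \<Rightarrow> bool" where
  "runs_tested I S j \<longleftrightarrow>
     Exec_Untested j \<notin> snd ` set S \<and>
     (\<exists>s s'. (s, Test j) \<in> set S \<and> (s', Exec_Tested j) \<in> set S \<and> s + test_time I j \<le> s')"

definition feasible :: "instance_data \<Rightarrow> schedule \<Rightarrow> bool" where
  "feasible I S \<longleftrightarrow>
     sequential_from I 0 S \<and> distinct (map snd S) \<and>
     (\<forall>(s, k) \<in> set S. job_of k < num_jobs I) \<and>
     (\<forall>j < num_jobs I. runs_untested S j \<or> runs_tested I S j)"

definition completion_time :: "instance_data \<Rightarrow> schedule \<Rightarrow> nat \<Rightarrow> real" where
  "completion_time I S j =
     (THE C. \<exists>s k. (s, k) \<in> set S \<and> k \<in> {Exec_Tested j, Exec_Untested j} \<and>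
        C = s + duration I k)"

definition cost :: "instance_data \<Rightarrow> schedule \<Rightarrow> real" where
  "cost I S = (\<Sum>j < num_jobs I. completion_time I S j)"

definition opt_cost :: "instance_data \<Rightarrow> real" where
  "opt_cost I = (INF S \<in> {S. feasible I S}. cost I S)"

text \<open>The queue holds pairs of a weight and a task; as no task is ever inserted twice,
  a set suffices.\<close>

definition initial_queue :: "real \<Rightarrow> real \<Rightarrow> instance_data \<Rightarrow> (real \<times> task) set" where
  "initial_queue \<alpha> \<beta> I =
     (\<lambda>j. if upper_limit I j \<ge> \<alpha> * test_time I j then (\<beta> * test_time I j, Test j)
          else (upper_limit I j, Exec_Untested j)) ` {..<num_jobs I}"

fun inserted_after :: "instance_data \<Rightarrow> task \<Rightarrow> (real \<times> task) set" where
  "inserted_after I (Test j) = {(test_time I j + proc_time I j, Exec_Tested j)}"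
| "inserted_after I (Exec_Tested j) = {}"
| "inserted_after I (Exec_Untested j) = {}"

text \<open>\<open>pcp_run I \<tau> Q S\<close>: starting at time \<open>\<tau>\<close> with queue \<open>Q\<close>, the tasks run from then on
  may form the schedule \<open>S\<close>. Any task of minimal weight may be extracted, so every way of
  breaking ties is covered.\<close>

inductive pcp_run :: "instance_data \<Rightarrow> real \<Rightarrow> (real \<times> task) set \<Rightarrow> schedule \<Rightarrow> bool"
  for I :: instance_data where
  pcp_stop: "pcp_run I \<tau> {} []"
| pcp_step: "pcp_run I \<tau> Q ((\<tau>, k) # S)"
    if "(w, k) \<in> Q" "\<forall>(w', k') \<in> Q. w \<le> w'"
      "pcp_run I (\<tau> + duration I k) ((Q - {(w, k)}) \<union> inserted_after I k) S"

text \<open>An algorithm is represented by the set of schedules it may produce on each instance.\<close>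

definition pcp :: "real \<Rightarrow> real \<Rightarrow> instance_data \<Rightarrow> schedule set" where
  "pcp \<alpha> \<beta> I = {S. pcp_run I 0 (initial_queue \<alpha> \<beta> I) S}"

definition competitive :: "(instance_data \<Rightarrow> schedule set) \<Rightarrow> real \<Rightarrow> bool" where
  "competitive A c \<longleftrightarrow>
     (\<forall>I. valid_instance I \<longrightarrow> (\<forall>S \<in> A I. cost I S \<le> c * opt_cost I))"

text \<open>Taken in the extended reals, so that an algorithm that is not competitive for any
  constant has ratio \<open>\<infinity>\<close>.\<close>

definition competitive_ratio :: "(instance_data \<Rightarrow> schedule set) \<Rightarrow> ereal" where
  "competitive_ratio A = Inf (ereal ` {c. competitive A c})"

end

theory Submission
  imports Defs
begin

text \<open>Split every completion time into the contributions of the individual jobs. In any feasible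
  schedule, two jobs \<open>i \<noteq> j\<close> delay each other by at least the smaller of their optimal durations
  \<open>p\<^sub>i\<^sup>*\<close> and \<open>p\<^sub>j\<^sup>*\<close>, since the job finishing first is
  processed completely before the other one finishes. In a run of PCP, the order of the weights
  determines the mutual delay of two jobs, and a case distinction over the possible orders bounds
  it by \<open>R\<close> times this minimum, where \<open>R\<close> is the claimed ratio. So the ratio holds pair by pair,
  and no exchange argument for the optimal schedule is needed.\<close>

section \<open>Order of first occurrence in a list\<close>

text \<open>For an \<open>a\<close> outside the list this is all of \<open>set xs\<close>.
  Transitivity and antisymmetry hold even then; only totality asks for membership.\<close>

definition preds :: "'a list \<Rightarrow> 'a \<Rightarrow> 'a set" where
  "preds xs a = set (takeWhile (\<lambda>x. x \<noteq> a) xs)"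

lemma preds_simps [simp]:
  "preds [] a = {}"
  "preds (x # xs) a = (if x = a then {} else insert x (preds xs a))"
  by (simp add: preds_def) (cases "x = a"; simp add: preds_def)

lemma finite_preds [simp]: "finite (preds xs a)"
  by (simp add: preds_def)

lemma preds_subset: "preds xs a \<subseteq> set xs"
  by (auto simp: preds_def dest: set_takeWhileD)

lemma preds_irrefl [simp]: "a \<notin> preds xs a"
  by (induction xs) auto

lemma preds_total: "a \<in> set xs \<Longrightarrow> b \<in> set xs \<Longrightarrow> a \<noteq> b \<Longrightarrow> a \<in> preds xs b \<or> b \<in> preds xs a"
  by (induction xs) auto

lemma preds_antisym: "a \<in> preds xs b \<Longrightarrow> b \<notin> preds xs a"
  by (induction xs) (auto split: if_splits)

lemma preds_trans: "a \<in> preds xs b \<Longrightarrow> b \<in> preds xs c \<Longrightarrow> a \<in> preds xs c"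
  by (induction xs) (auto split: if_splits)

section \<open>Contributions of jobs to completion times\<close>

definition final_task :: "schedule \<Rightarrow> nat \<Rightarrow> task" where
  "final_task S j = (if Exec_Untested j \<in> snd ` set S then Exec_Untested j else Exec_Tested j)"

text \<open>Taken by position in the list rather than by start times, so that tasks of length 0
  create no ties.\<close>

definition done_tasks :: "schedule \<Rightarrow> nat \<Rightarrow> task set" where
  "done_tasks S j = insert (final_task S j) (preds (map snd S) (final_task S j))"

text \<open>Job \<open>i\<close> delays, job \<open>j\<close> is delayed. Summed over
  \<open>i\<close>, this is the completion time of \<open>j\<close> apart from idle time.\<close>

definition contrib :: "instance_data \<Rightarrow> schedule \<Rightarrow> nat \<Rightarrow> nat \<Rightarrow> real" where
  "contrib I S i j = (\<Sum>k | k \<in> done_tasks S j \<and> job_of k = i. duration I k)"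

definition opt_time :: "instance_data \<Rightarrow> nat \<Rightarrow> real" where
  "opt_time I j = min (upper_limit I j) (test_time I j + proc_time I j)"

text \<open>Sums over all ordered pairs count every unordered pair twice but the diagonal only once;
  hence the factor 2 on the diagonal.\<close>

definition pair_bound :: "instance_data \<Rightarrow> nat \<Rightarrow> nat \<Rightarrow> real" where
  "pair_bound I i j = (if i = j then 2 * opt_time I i else min (opt_time I i) (opt_time I j))"

lemma duration_nonneg: "valid_instance I \<Longrightarrow> job_of k < num_jobs I \<Longrightarrow> 0 \<le> duration I k"
  by (cases k) (auto simp: valid_instance_def)

lemma finite_done_tasks [simp]: "finite (done_tasks S j)"
  by (simp add: done_tasks_def)

lemma contrib_eq:
  "contrib I S i j =
    (if Test i \<in> done_tasks S j then test_time I i else 0) +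
    (if Exec_Tested i \<in> done_tasks S j then proc_time I i else 0) +
    (if Exec_Untested i \<in> done_tasks S j then upper_limit I i else 0)"
proof -
  have "{k. k \<in> done_tasks S j \<and> job_of k = i} =
      {Test i, Exec_Tested i, Exec_Untested i} \<inter> done_tasks S j"
    by (auto elim: job_of.elims[OF sym])
  then have "contrib I S i j =
      (\<Sum>k\<in>{Test i, Exec_Tested i, Exec_Untested i}. if k \<in> done_tasks S j then duration I k else 0)"
    by (simp add: contrib_def sum.inter_restrict)
  then show ?thesis by simp
qed

text \<open>An inequality because the machine may idle; for PCP, which never idles,
  \<open>pcp_run_start\<close> gives equality.\<close>

lemma sequential_start_ge:
  assumes "sequential_from I \<tau> S" "distinct (map snd S)" "(s, k) \<in> set S"
    "\<And>k'. k' \<in> snd ` set S \<Longrightarrow> 0 \<le> duration I k'"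
  shows "\<tau> + (\<Sum>k'\<in>preds (map snd S) k. duration I k') \<le> s"
  using assms
proof (induction S arbitrary: \<tau>)
  case (Cons x S)
  obtain s0 k0 where x: "x = (s0, k0)" by force
  show ?case
  proof (cases "k0 = k")
    case True
    then show ?thesis using Cons.prems x by force
  next
    case False
    then have "s0 + duration I k0 + (\<Sum>k'\<in>preds (map snd S) k. duration I k') \<le> s"
      using Cons.prems x by (intro Cons.IH) auto
    moreover have "k0 \<notin> preds (map snd S) k"
      using Cons.prems x preds_subset[of "map snd S" k] by auto
    ultimately show ?thesis using Cons.prems x False by auto
  qed
qed simp

lemma sequential_order:
  assumes "sequential_from I \<tau> S" "distinct (map snd S)" "k \<in> preds (map snd S) k'"
    "(s, k) \<in> set S" "(s', k') \<in> set S"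
    "\<And>l. l \<in> snd ` set S \<Longrightarrow> 0 \<le> duration I l"
  shows "s + duration I k \<le> s'"
  using assms
proof (induction S arbitrary: \<tau>)
  case (Cons x S)
  obtain s0 k0 where x: "x = (s0, k0)" by force
  have S: "sequential_from I (s0 + duration I k0) S" "distinct (map snd S)" "(s', k') \<in> set S"
    "\<And>l. l \<in> snd ` set S \<Longrightarrow> 0 \<le> duration I l"
    using Cons.prems x by (auto split: if_splits)
  show ?case
  proof (cases "k0 = k")
    case True
    have "0 \<le> (\<Sum>l\<in>preds (map snd S) k'. duration I l)"
      by (intro sum_nonneg S(4)) (use preds_subset[of "map snd S" k'] in auto)
    then have "s0 + duration I k0 \<le> s'"
      using sequential_start_ge[OF S] by linarith
    moreover have "s = s0" using Cons.prems x True by force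
    ultimately show ?thesis using True by simp
  next
    case False
    then show ?thesis using Cons.prems(3,4) S x by (intro Cons.IH) (auto split: if_splits)
  qed
qed simp

text \<open>Resolves the definite description in \<open>completion_time\<close>: feasibility leaves
  exactly one execution task for \<open>j\<close>, and distinctness of the tasks makes its start
  time unique.\<close>

lemma feasible_final_task:
  assumes "feasible I S" "j < num_jobs I"
  obtains s where "(s, final_task S j) \<in> set S"
    "completion_time I S j = s + duration I (final_task S j)"
proof -
  have tested: "runs_untested S j \<or> runs_tested I S j" and inj: "inj_on snd (set S)"
    using assms by (auto simp: feasible_def distinct_map)
  obtain s where s: "(s, final_task S j) \<in> set S"
    using tested by (force simp: runs_untested_def runs_tested_def final_task_def)
  have only: "k = final_task S j"
    if "(s', k) \<in> set S" "k \<in> {Exec_Tested j, Exec_Untested j}" for s' k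
    using tested that by (force simp: runs_untested_def runs_tested_def final_task_def)
  have "completion_time I S j = s + duration I (final_task S j)"
    unfolding completion_time_def
  proof (rule the_equality)
    show "\<exists>s' k. (s', k) \<in> set S \<and> k \<in> {Exec_Tested j, Exec_Untested j} \<and>
        s + duration I (final_task S j) = s' + duration I k"
      using s by (intro exI[of _ s] exI[of _ "final_task S j"]) (auto simp: final_task_def)
  next
    fix C
    assume "\<exists>s' k. (s', k) \<in> set S \<and> k \<in> {Exec_Tested j, Exec_Untested j} \<and> C = s' + duration I k"
    then obtain s' k where k: "(s', k) \<in> set S" "k \<in> {Exec_Tested j, Exec_Untested j}"
      "C = s' + duration I k" by blast
    then have "k = final_task S j" using only by blast
    then show "C = s + duration I (final_task S j)" using k s inj_onD[OF inj, of "(s', k)" "(s, k)"] by auto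
  qed
  with s show thesis by (rule that)
qed

lemma sum_contrib:
  assumes "feasible I S" "j < num_jobs I"
  shows "(\<Sum>i<num_jobs I. contrib I S i j) =
    duration I (final_task S j) + (\<Sum>k\<in>preds (map snd S) (final_task S j). duration I k)"
proof -
  obtain s where "(s, final_task S j) \<in> set S"
    using feasible_final_task[OF assms] .
  then have "job_of ` done_tasks S j \<subseteq> {..<num_jobs I}"
    using assms(1) preds_subset[of "map snd S" "final_task S j"]
    by (force simp: done_tasks_def feasible_def)
  then have "(\<Sum>i<num_jobs I. contrib I S i j) = (\<Sum>k\<in>done_tasks S j. duration I k)"
    unfolding contrib_def by (intro sum.group) auto
  then show ?thesis by (simp add: done_tasks_def)
qed

text \<open>Turns a sum of contributions into one of mutual delays, so that two costs can be
  compared pair by pair.\<close>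

lemma sum_sum_symmetrize:
  fixes f :: "nat \<Rightarrow> nat \<Rightarrow> real"
  shows "2 * (\<Sum>j<n. \<Sum>i<n. f i j) = (\<Sum>i<n. \<Sum>j<n. f i j + f j i)"
  using sum.swap[of f "{..<n}" "{..<n}"] by (simp add: sum.distrib)

section \<open>Lower bound for every feasible schedule\<close>

text \<open>Once \<open>i\<close> is finished, it has received u_i if untested, and otherwise t_i +
  p_i, since its test precedes its execution.\<close>

lemma contrib_ge_opt_time:
  assumes "valid_instance I" "feasible I S" "i < num_jobs I" "final_task S i \<in> done_tasks S j"
  shows "opt_time I i \<le> contrib I S i j"
proof -
  have nn: "0 \<le> test_time I i" "0 \<le> proc_time I i" "0 \<le> upper_limit I i"
    using assms by (auto simp: valid_instance_def)
  have seq: "sequential_from I 0 S" "distinct (map snd S)" and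
    nonneg: "\<And>k. k \<in> snd ` set S \<Longrightarrow> 0 \<le> duration I k"
    using assms duration_nonneg by (auto simp: feasible_def)
  consider "runs_untested S i" | "runs_tested I S i"
    using assms by (auto simp: feasible_def)
  then show ?thesis
  proof cases
    case 1
    then have "Exec_Untested i \<in> done_tasks S j"
      using assms(4) by (auto simp: runs_untested_def final_task_def)
    then show ?thesis using nn by (auto simp: contrib_eq opt_time_def)
  next
    case 2
    then have fin: "final_task S i = Exec_Tested i"
      by (auto simp: runs_tested_def final_task_def)
    have exec: "Exec_Tested i \<in> done_tasks S j" using assms(4) fin by simp
    have "Test i \<in> done_tasks S j \<or> test_time I i = 0"
    proof (cases "Test i \<in> preds (map snd S) (Exec_Tested i)")
      case True
      then show ?thesis
        using exec by (auto simp: done_tasks_def intro: preds_trans)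
    next
      txt \<open>Feasibility only constrains start times, so a test of length 0 may be listed after the
        execution if the latter has length 0 as well.\<close>
      case False
      obtain s s' where s: "(s, Test i) \<in> set S" "(s', Exec_Tested i) \<in> set S"
        "s + test_time I i \<le> s'"
        using 2 by (auto simp: runs_tested_def)
      have "Exec_Tested i \<in> preds (map snd S) (Test i)"
        using False s preds_total[of "Exec_Tested i" "map snd S" "Test i"] by force
      \<comment> \<open>Together with s + t_i \<le> s' from feasibility this gives t_i + p_i \<le>
        0, so the missing test has length 0.\<close>
      then have "s' + duration I (Exec_Tested i) \<le> s"
        using sequential_order[OF seq _ s(2,1) nonneg] by blast
      then show ?thesis using s nn by auto
    qed
    then show ?thesis using exec nn by (auto simp: contrib_eq opt_time_def)
  qed
qed

text \<open>Of two distinct jobs, the one whose final task is listed first is finished when the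
  other completes, so it alone contributes enough.\<close>

lemma pair_bound_le_contrib:
  assumes "valid_instance I" "feasible I S" "i < num_jobs I" "j < num_jobs I"
  shows "pair_bound I i j \<le> contrib I S i j + contrib I S j i"
proof (cases "i = j")
  case True
  then show ?thesis
    using contrib_ge_opt_time[OF assms(1,2,3), of i] by (simp add: pair_bound_def done_tasks_def)
next
  case False
  obtain s s' where "(s, final_task S i) \<in> set S" "(s', final_task S j) \<in> set S"
    using feasible_final_task[OF assms(2)] assms(3,4) by metis
  then have "final_task S i \<in> set (map snd S)" "final_task S j \<in> set (map snd S)"
    by force+
  moreover have "final_task S i \<noteq> final_task S j"
    using False by (auto simp: final_task_def)
  ultimately have "final_task S i \<in> done_tasks S j \<or> final_task S j \<in> done_tasks S i"
    unfolding done_tasks_def using preds_total by fast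
  moreover have "0 \<le> contrib I S i j" "0 \<le> contrib I S j i"
    using assms by (auto simp: contrib_eq valid_instance_def)
  ultimately show ?thesis
    using False contrib_ge_opt_time[OF assms(1,2,3), of j] contrib_ge_opt_time[OF assms(1,2,4), of i]
    by (auto simp: pair_bound_def)
qed

lemma cost_ge_pair_bounds:
  assumes "valid_instance I" "feasible I S"
  shows "(\<Sum>i<num_jobs I. \<Sum>j<num_jobs I. pair_bound I i j) \<le> 2 * cost I S"
proof -
  have "(\<Sum>i<num_jobs I. contrib I S i j) \<le> completion_time I S j" if j: "j < num_jobs I" for j
  proof -
    obtain s where s: "(s, final_task S j) \<in> set S"
      "completion_time I S j = s + duration I (final_task S j)"
      using feasible_final_task[OF assms(2) j] .
    then have "0 + (\<Sum>k\<in>preds (map snd S) (final_task S j). duration I k) \<le> s"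
      using assms duration_nonneg by (intro sequential_start_ge) (auto simp: feasible_def)
    then show ?thesis using s sum_contrib[OF assms(2) j] by simp
  qed
  then have "(\<Sum>j<num_jobs I. \<Sum>i<num_jobs I. contrib I S i j) \<le> cost I S"
    unfolding cost_def by (intro sum_mono) auto
  moreover have "(\<Sum>i<num_jobs I. \<Sum>j<num_jobs I. pair_bound I i j) \<le>
      (\<Sum>i<num_jobs I. \<Sum>j<num_jobs I. contrib I S i j + contrib I S j i)"
    using assms by (intro sum_mono pair_bound_le_contrib) auto
  ultimately show ?thesis
    using sum_sum_symmetrize[of "contrib I S" "num_jobs I"] by linarith
qed

section \<open>Runs of PCP\<close>

text \<open>The weight depends on the task alone, so runs can be discussed without carrying along
  the queue entries.\<close>

fun weight :: "real \<Rightarrow> instance_data \<Rightarrow> task \<Rightarrow> real" where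
  "weight \<beta> I (Test j) = \<beta> * test_time I j"
| "weight \<beta> I (Exec_Tested j) = test_time I j + proc_time I j"
| "weight \<beta> I (Exec_Untested j) = upper_limit I j"

lemma pcp_run_set:
  "pcp_run I \<tau> Q S \<Longrightarrow> snd ` set S = snd ` Q \<union> {Exec_Tested j | j. Test j \<in> snd ` Q}"
proof (induction rule: pcp_run.induct)
  case (pcp_step w k Q \<tau> S)
  have "snd ` Q = insert k (snd ` (Q - {(w, k)}))" using pcp_step(1) by force
  then show ?case using pcp_step.IH by (cases k) (auto simp: image_Un)
qed simp

text \<open>The invariant is that the queue holds at most one task per job; an inserted execution
  only replaces its test.\<close>

lemma pcp_run_distinct:
  "pcp_run I \<tau> Q S \<Longrightarrow> inj_on (job_of \<circ> snd) Q \<Longrightarrow> distinct (map snd S)"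
proof (induction rule: pcp_run.induct)
  case (pcp_step w k Q \<tau> S)
  have "inj_on (job_of \<circ> snd) (insert (w, k) (Q - {(w, k)}))"
    unfolding insert_Diff[OF pcp_step(1)] by (rule pcp_step.prems)
  then have inj: "inj_on (job_of \<circ> snd) (Q - {(w, k)})"
    and other: "job_of k \<notin> job_of ` snd ` (Q - {(w, k)})"
    unfolding inj_on_insert by (auto simp: image_iff)
  have "inj_on (job_of \<circ> snd) (Q - {(w, k)} \<union> inserted_after I k)"
    using inj other by (cases k) (auto simp: image_iff)
  then have dist: "distinct (map snd S)" by (rule pcp_step.IH)
  have absent: "k' \<notin> snd ` (Q - {(w, k)})" if "job_of k' = job_of k" for k'
    using other that by (metis imageI)
  \<comment> \<open>\<open>k\<close> could recur only if it, or the test that inserts it, were still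
    in \<open>Q - {(w, k)}\<close>; either would be a second task of the same job.\<close>
  have "k \<notin> snd ` set S"
    unfolding pcp_run_set[OF pcp_step(3)] image_Un
    using absent[of k] absent[of "Test (job_of k)"] by (cases k) simp_all
  with dist show ?case by simp
qed simp

lemma pcp_run_sequential: "pcp_run I \<tau> Q S \<Longrightarrow> sequential_from I \<tau> S"
  by (induction rule: pcp_run.induct) auto

lemma pcp_run_start:
  "pcp_run I \<tau> Q S \<Longrightarrow> distinct (map snd S) \<Longrightarrow> (s, k) \<in> set S \<Longrightarrow>
    s = \<tau> + (\<Sum>k'\<in>preds (map snd S) k. duration I k')"
proof (induction rule: pcp_run.induct)
  case (pcp_step w k0 Q \<tau> S)
  then show ?case
  proof (cases "k0 = k")
    case True
    then show ?thesis using pcp_step.prems by force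
  next
    case False
    moreover have "k0 \<notin> preds (map snd S) k"
      using pcp_step.prems preds_subset[of "map snd S" k] by auto
    ultimately show ?thesis using pcp_step by auto
  qed
qed simp

text \<open>An execution that is not queued at the start can be inserted only by running its
  test.\<close>

lemma pcp_run_test_first:
  "pcp_run I \<tau> Q S \<Longrightarrow> Exec_Tested j \<in> snd ` set S \<Longrightarrow>
    Exec_Tested j \<in> snd ` Q \<or> Test j \<in> preds (map snd S) (Exec_Tested j)"
proof (induction rule: pcp_run.induct)
  case (pcp_step w k Q \<tau> S)
  show ?case
  proof (cases "k = Exec_Tested j")
    case True
    then show ?thesis using pcp_step(1) by force
  next
    case False
    then have "Exec_Tested j \<in> snd ` (Q - {(w, k)} \<union> inserted_after I k) \<or>
        Test j \<in> preds (map snd S) (Exec_Tested j)"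
      using pcp_step.IH pcp_step.prems by auto
    then show ?thesis using False by (cases k) auto
  qed
qed simp

text \<open>The last assumption says that \<open>b\<close> is already in the queue when
  \<open>a\<close> is extracted: it was there from the start, or its test ran before
  \<open>a\<close>. Minimality of the extracted weight then gives the claim. List order alone would
  not do, since an execution can be lighter than its own test.\<close>

lemma pcp_run_weight_le:
  assumes "pcp_run I \<tau> Q S" "\<And>w k. (w, k) \<in> Q \<Longrightarrow> w = weight \<beta> I k"
    "a \<in> preds (map snd S) b"
    "b \<in> snd ` Q \<or> (\<exists>j. b = Exec_Tested j \<and> Test j \<in> preds (map snd S) a)"
  shows "weight \<beta> I a \<le> weight \<beta> I b"
  using assms
proof (induction rule: pcp_run.induct)
  case (pcp_step w k Q \<tau> S)
  let ?Q = "Q - {(w, k)} \<union> inserted_after I k"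
  show ?case
  proof (cases "a = k")
    case True
    then obtain w' where "(w', b) \<in> Q" using pcp_step.prems by auto
    then show ?thesis using pcp_step(1,2) pcp_step.prems(1) True by fastforce
  next
    case False
    have "w' = weight \<beta> I k'" if "(w', k') \<in> ?Q" for w' k'
      using that pcp_step.prems(1) by (cases k) auto
    moreover have "a \<in> preds (map snd S) b" "b \<noteq> k"
      using pcp_step.prems False by (auto split: if_splits)
    moreover have "b \<in> snd ` ?Q \<or> (\<exists>j. b = Exec_Tested j \<and> Test j \<in> preds (map snd S) a)"
      using pcp_step.prems(3) False \<open>b \<noteq> k\<close> by (force simp: image_Un)
    ultimately show ?thesis using pcp_step.IH by blast
  qed
qed simp

section \<open>A fixed run of PCP: order of tasks, feasibility and exact cost\<close>

context
  fixes \<alpha> \<beta> :: real and I :: instance_data and S :: schedule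
  assumes valid: "valid_instance I" and S: "S \<in> pcp \<alpha> \<beta> I"
begin

definition tested :: "nat \<Rightarrow> bool" where
  "tested j \<longleftrightarrow> \<alpha> * test_time I j \<le> upper_limit I j"

lemma pcp_run_S: "pcp_run I 0 (initial_queue \<alpha> \<beta> I) S"
  using S by (simp add: pcp_def)

lemma snd_initial_queue:
  "snd ` initial_queue \<alpha> \<beta> I =
    (\<lambda>j. if tested j then Test j else Exec_Untested j) ` {..<num_jobs I}"
  by (force simp: initial_queue_def tested_def image_image)

lemma pcp_set:
  "Test j \<in> snd ` set S \<longleftrightarrow> j < num_jobs I \<and> tested j"
  "Exec_Tested j \<in> snd ` set S \<longleftrightarrow> j < num_jobs I \<and> tested j"
  "Exec_Untested j \<in> snd ` set S \<longleftrightarrow> j < num_jobs I \<and> \<not> tested j"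
  unfolding pcp_run_set[OF pcp_run_S] snd_initial_queue by (auto split: if_splits)

lemma pcp_distinct: "distinct (map snd S)"
  by (rule pcp_run_distinct[OF pcp_run_S])
    (auto simp: inj_on_def initial_queue_def split: if_splits)

lemma pcp_test_first:
  assumes "j < num_jobs I" "tested j"
  shows "Test j \<in> preds (map snd S) (Exec_Tested j)"
  using pcp_run_test_first[OF pcp_run_S, of j] pcp_set(2)[of j] assms
  by (auto simp: snd_initial_queue split: if_splits)

text \<open>Only executions of tested jobs are missing from the initial queue, so only they carry a
  condition on their test.\<close>

lemma pcp_weight_le:
  assumes "a \<in> preds (map snd S) b" "b \<in> snd ` set S"
    "\<And>j. b = Exec_Tested j \<Longrightarrow> Test j \<in> preds (map snd S) a"
  shows "weight \<beta> I a \<le> weight \<beta> I b"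
proof (rule pcp_run_weight_le[OF pcp_run_S _ assms(1)])
  show "w = weight \<beta> I k" if "(w, k) \<in> initial_queue \<alpha> \<beta> I" for w k
    using that by (auto simp: initial_queue_def split: if_splits)
  show "b \<in> snd ` initial_queue \<alpha> \<beta> I \<or> (\<exists>j. b = Exec_Tested j \<and> Test j \<in> preds (map snd S) a)"
    using assms(2,3) unfolding pcp_run_set[OF pcp_run_S] by auto
qed

lemma pcp_start: "(s, k) \<in> set S \<Longrightarrow> s = (\<Sum>k'\<in>preds (map snd S) k. duration I k')"
  using pcp_run_start[OF pcp_run_S pcp_distinct] by simp

lemma pcp_jobs: "k \<in> snd ` set S \<Longrightarrow> job_of k < num_jobs I"
  by (cases k) (simp_all add: pcp_set)

lemma pcp_feasible: "feasible I S"
proof -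
  have "runs_untested S j \<or> runs_tested I S j" if j: "j < num_jobs I" for j
  proof (cases "tested j")
    case True
    then obtain s s' where s: "(s, Test j) \<in> set S" "(s', Exec_Tested j) \<in> set S"
      using j pcp_set(1,2)[of j] by fastforce
    have first: "Test j \<in> preds (map snd S) (Exec_Tested j)"
      using pcp_test_first j True by blast
    \<comment> \<open>Without idle time start times are sums over predecessors, so the order in time
      reduces to an inclusion of predecessor sets.\<close>
    have "s + test_time I j = (\<Sum>k\<in>insert (Test j) (preds (map snd S) (Test j)). duration I k)"
      using pcp_start[OF s(1)] by simp
    also have "\<dots> \<le> (\<Sum>k\<in>preds (map snd S) (Exec_Tested j). duration I k)"
    proof (rule sum_mono2)
      show "insert (Test j) (preds (map snd S) (Test j)) \<subseteq> preds (map snd S) (Exec_Tested j)"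
        using first preds_trans by fast
      show "0 \<le> duration I k" if "k \<in> preds (map snd S) (Exec_Tested j) -
          insert (Test j) (preds (map snd S) (Test j))" for k
        using that preds_subset[of "map snd S" "Exec_Tested j"] valid
        by (intro duration_nonneg pcp_jobs) auto
    qed simp
    also have "\<dots> = s'" using pcp_start[OF s(2)] by simp
    finally show ?thesis using s True pcp_set(3)[of j] by (auto simp: runs_tested_def)
  next
    case False
    then show ?thesis using j pcp_set[of j] by (auto simp: runs_untested_def)
  qed
  moreover have "\<forall>(s, k) \<in> set S. job_of k < num_jobs I"
    using pcp_jobs by force
  ultimately show ?thesis
    using pcp_run_sequential[OF pcp_run_S] pcp_distinct by (simp add: feasible_def)
qed

lemma pcp_cost: "2 * cost I S = (\<Sum>i<num_jobs I. \<Sum>j<num_jobs I. contrib I S i j + contrib I S j i)"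
proof -
  have "completion_time I S j = (\<Sum>i<num_jobs I. contrib I S i j)" if j: "j < num_jobs I" for j
  proof -
    obtain s where "(s, final_task S j) \<in> set S"
      "completion_time I S j = s + duration I (final_task S j)"
      using feasible_final_task[OF pcp_feasible j] .
    then show ?thesis using pcp_start sum_contrib[OF pcp_feasible j] by simp
  qed
  then have "cost I S = (\<Sum>j<num_jobs I. \<Sum>i<num_jobs I. contrib I S i j)"
    by (simp add: cost_def)
  then show ?thesis by (simp only: sum_sum_symmetrize)
qed

lemma pcp_final_task:
  "j < num_jobs I \<Longrightarrow> final_task S j = (if tested j then Exec_Tested j else Exec_Untested j)"
  using pcp_set(3)[of j] by (auto simp: final_task_def)

lemma pcp_done_tasks: "k \<in> done_tasks S j \<Longrightarrow> j < num_jobs I \<Longrightarrow> k \<in> snd ` set S"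
  using preds_subset[of "map snd S" "final_task S j"] pcp_set[of j]
  by (auto simp: done_tasks_def pcp_final_task split: if_splits)

text \<open>For distinct jobs the final task of \<open>j\<close> itself belongs to \<open>j\<close>,
  so \<open>preds\<close> can replace \<open>done_tasks\<close>.\<close>

lemma contrib_untested:
  assumes "i < num_jobs I" "j < num_jobs I" "i \<noteq> j" "\<not> tested i"
  shows "contrib I S i j =
    (if Exec_Untested i \<in> preds (map snd S) (final_task S j) then upper_limit I i else 0)"
proof -
  have "Test i \<notin> done_tasks S j" "Exec_Tested i \<notin> done_tasks S j"
    using pcp_done_tasks[OF _ assms(2)] pcp_set(1,2)[of i] assms(4) by blast+
  then show ?thesis using assms by (simp add: contrib_eq done_tasks_def pcp_final_task)
qed

lemma contrib_tested:
  assumes "i < num_jobs I" "j < num_jobs I" "i \<noteq> j" "tested i"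
  shows "contrib I S i j =
    (if Test i \<in> preds (map snd S) (final_task S j) then test_time I i else 0) +
    (if Exec_Tested i \<in> preds (map snd S) (final_task S j) then proc_time I i else 0)"
proof -
  have "Exec_Untested i \<notin> done_tasks S j"
    using pcp_done_tasks[OF _ assms(2)] pcp_set(3)[of i] assms(4) by blast
  then show ?thesis using assms by (simp add: contrib_eq done_tasks_def pcp_final_task)
qed

section \<open>Time spent on a single job, compared with its optimal time\<close>

context
  fixes R :: real
  assumes \<alpha>: "\<alpha> \<ge> 1" and \<beta>: "\<beta> \<ge> 1"
    and R1: "\<alpha> * (1 + 1 / \<beta>) \<le> R" and R2: "(1 + 1 / \<alpha>) * (1 + 1 / \<beta>) \<le> R"
    and R3: "\<beta> \<le> R" and R4: "2 \<le> R" and R5: "1 + 2 / \<alpha> \<le> R"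
begin

lemma nonneg:
  assumes "j < num_jobs I"
  shows "0 \<le> test_time I j" "0 \<le> proc_time I j" "proc_time I j \<le> upper_limit I j"
    "0 \<le> upper_limit I j" "0 \<le> opt_time I j"
  using assms valid by (auto simp: valid_instance_def opt_time_def)

text \<open>Leaving \<open>j\<close> untested means u_j < \<alpha> t_j, hence u_j \<le> \<alpha>
  \<open>opt_time I j\<close>. In the second bound, \<open>x\<close> stands for a test of another
  job run earlier, whose weight \<beta> x is at most u_j; this costs the factor \<alpha> (1 +
  1/\<beta>).\<close>

lemma untested_bounds:
  assumes j: "j < num_jobs I" "\<not> tested j"
  shows "upper_limit I j \<le> R * opt_time I j"
    "x \<le> upper_limit I j / \<beta> \<Longrightarrow> upper_limit I j + x \<le> R * opt_time I j"
proof -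
  have "upper_limit I j \<le> \<alpha> * upper_limit I j"
    using nonneg[OF j(1)] \<alpha> by (simp add: mult_le_cancel_right1)
  moreover have "upper_limit I j \<le> \<alpha> * (test_time I j + proc_time I j)"
    using nonneg[OF j(1)] j(2) \<alpha> mult_nonneg_nonneg[of \<alpha> "proc_time I j"]
    unfolding tested_def distrib_left by linarith
  ultimately have u: "upper_limit I j \<le> \<alpha> * opt_time I j"
    by (simp add: opt_time_def min_def)
  have "upper_limit I j + upper_limit I j / \<beta> = (1 + 1 / \<beta>) * upper_limit I j"
    by (simp add: algebra_simps)
  also have "\<dots> \<le> (1 + 1 / \<beta>) * (\<alpha> * opt_time I j)"
    using u \<beta> by (intro mult_left_mono) auto
  also have "\<dots> \<le> R * opt_time I j"
    using mult_right_mono[OF R1 nonneg(5)[OF j(1)]] by (simp add: mult_ac)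
  finally have *: "upper_limit I j + upper_limit I j / \<beta> \<le> R * opt_time I j" .
  then show "x \<le> upper_limit I j / \<beta> \<Longrightarrow> upper_limit I j + x \<le> R * opt_time I j" by simp
  show "upper_limit I j \<le> R * opt_time I j"
    using * nonneg(4)[OF j(1)] \<beta> divide_nonneg_nonneg[of "upper_limit I j" \<beta>] by linarith
qed

text \<open>Testing \<open>j\<close> means t_j \<le> u_j / \<alpha>. The first bound uses t_j \<le>
  \<open>opt_time I j\<close> and \<open>R3\<close>. For 2 t_j + p_j, comparison with t_j + p_j
  needs factor 2 (\<open>R4\<close>) and comparison with u_j needs 1 + 2/\<alpha>
  (\<open>R5\<close>). The last one combines t_j + p_j \<le> (1 + 1/\<alpha>)
  \<open>opt_time I j\<close> with an earlier test of another job, of length \<open>x\<close>,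
  giving \<open>R2\<close>.\<close>

lemma tested_bounds:
  assumes j: "j < num_jobs I" "tested j"
  shows "x \<le> \<beta> * test_time I j \<Longrightarrow> x \<le> R * opt_time I j"
    "2 * test_time I j + proc_time I j \<le> R * opt_time I j"
    "test_time I j + proc_time I j \<le> R * opt_time I j"
    "x \<le> (test_time I j + proc_time I j) / \<beta> \<Longrightarrow>
      test_time I j + proc_time I j + x \<le> R * opt_time I j"
proof -
  note nn = nonneg[OF j(1)]
  have tu: "test_time I j \<le> upper_limit I j / \<alpha>"
    using j(2) \<alpha> by (simp add: tested_def field_simps)
  have "test_time I j \<le> upper_limit I j"
    using j(2) \<alpha> nn mult_right_mono[of 1 \<alpha> "test_time I j"] by (simp add: tested_def)
  then have "test_time I j \<le> opt_time I j" using nn by (simp add: opt_time_def)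
  then have "\<beta> * test_time I j \<le> \<beta> * opt_time I j" using \<beta> by simp
  also have "\<dots> \<le> R * opt_time I j" using R3 nn by (intro mult_right_mono)
  finally show "x \<le> \<beta> * test_time I j \<Longrightarrow> x \<le> R * opt_time I j" by simp
  have "2 * test_time I j + proc_time I j \<le> (1 + 2 / \<alpha>) * upper_limit I j"
    using tu nn unfolding distrib_right by simp
  also have "\<dots> \<le> R * upper_limit I j" using R5 nn by (intro mult_right_mono)
  finally have "2 * test_time I j + proc_time I j \<le> R * upper_limit I j" .
  moreover have "2 * test_time I j + proc_time I j \<le> R * (test_time I j + proc_time I j)"
    using R4 nn mult_right_mono[of 2 R "test_time I j + proc_time I j"] by simp
  ultimately show *: "2 * test_time I j + proc_time I j \<le> R * opt_time I j"
    by (simp add: opt_time_def min_def)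
  then show "test_time I j + proc_time I j \<le> R * opt_time I j" using nn by linarith
  have "test_time I j + proc_time I j \<le> (1 + 1 / \<alpha>) * upper_limit I j"
    using tu nn by (simp add: algebra_simps)
  moreover have "test_time I j + proc_time I j \<le> (1 + 1 / \<alpha>) * (test_time I j + proc_time I j)"
    using nn \<alpha> by (simp add: algebra_simps)
  ultimately have q: "test_time I j + proc_time I j \<le> (1 + 1 / \<alpha>) * opt_time I j"
    by (simp add: opt_time_def min_def)
  have "test_time I j + proc_time I j + (test_time I j + proc_time I j) / \<beta> =
      (1 + 1 / \<beta>) * (test_time I j + proc_time I j)"
    by (simp add: algebra_simps add_divide_distrib)
  also have "\<dots> \<le> (1 + 1 / \<beta>) * ((1 + 1 / \<alpha>) * opt_time I j)"
    using q \<beta> by (intro mult_left_mono) auto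
  also have "\<dots> \<le> R * opt_time I j"
    using mult_right_mono[OF R2 nn(5)] by (simp add: mult_ac)
  finally show "x \<le> (test_time I j + proc_time I j) / \<beta> \<Longrightarrow>
      test_time I j + proc_time I j + x \<le> R * opt_time I j" by simp
qed

section \<open>Mutual delay of two jobs, by the order of their tasks\<close>

lemma delay_untested_untested:
  assumes "i < num_jobs I" "j < num_jobs I" "\<not> tested i" "\<not> tested j"
    and before: "Exec_Untested i \<in> preds (map snd S) (Exec_Untested j)"
  shows "contrib I S i j + contrib I S j i \<le> R * min (opt_time I i) (opt_time I j)"
proof -
  have "upper_limit I i \<le> upper_limit I j"
    using pcp_weight_le[OF before] assms pcp_set by simp
  moreover have "i \<noteq> j" using before by auto
  then have "contrib I S i j + contrib I S j i = upper_limit I i"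
    using assms preds_antisym[OF before]
    by (auto simp: contrib_untested contrib_tested pcp_final_task)
  ultimately show ?thesis
    using untested_bounds(1)[of i] untested_bounds(1)[of j] assms by (auto simp: min_def)
qed

text \<open>The execution of \<open>i\<close> falls before the test of \<open>j\<close>, between
  test and execution, or after both. Each order yields a weight inequality that rewrites the delay
  as a multiple of either optimal time.\<close>

lemma delay_untested_tested:
  assumes i: "i < num_jobs I" "\<not> tested i" and j: "j < num_jobs I" "tested j"
  shows "contrib I S i j + contrib I S j i \<le> R * min (opt_time I i) (opt_time I j)"
proof -
  let ?P = "\<lambda>k l. k \<in> preds (map snd S) l"
  have ij: "i \<noteq> j" using i j by auto
  have test: "?P (Test j) (Exec_Tested j)" using pcp_test_first j .
  have mem: "Exec_Untested i \<in> set (map snd S)" "Test j \<in> set (map snd S)"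
    "Exec_Tested j \<in> set (map snd S)"
    using pcp_set i j by auto
  have contribs:
    "contrib I S i j = (if ?P (Exec_Untested i) (Exec_Tested j) then upper_limit I i else 0)"
    "contrib I S j i = (if ?P (Test j) (Exec_Untested i) then test_time I j else 0) +
      (if ?P (Exec_Tested j) (Exec_Untested i) then proc_time I j else 0)"
    using i j ij by (auto simp: contrib_untested contrib_tested pcp_final_task)
  have "contrib I S i j + contrib I S j i \<le> R * opt_time I i \<and>
      contrib I S i j + contrib I S j i \<le> R * opt_time I j"
  proof (cases "?P (Exec_Untested i) (Test j)")
    case True
    then have "upper_limit I i \<le> \<beta> * test_time I j"
      using pcp_weight_le[OF True] mem by simp
    moreover have "contrib I S i j + contrib I S j i = upper_limit I i"
      using True preds_trans[OF True test] by (simp add: contribs preds_antisym)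
    ultimately show ?thesis
      using untested_bounds(1)[OF i] tested_bounds(1)[OF j] by simp
  next
    case False
    then have before: "?P (Test j) (Exec_Untested i)" using preds_total mem by fastforce
    have t: "test_time I j \<le> upper_limit I i / \<beta>"
      using pcp_weight_le[OF before] mem \<beta> by (simp add: field_simps)
    show ?thesis
    proof (cases "?P (Exec_Untested i) (Exec_Tested j)")
      case True
      \<comment> \<open>Here the delay u_i + t_j is at most u_i + u_i / \<beta> on the side of
        \<open>i\<close> and at most 2 t_j + p_j on the side of \<open>j\<close>.\<close>
      have "upper_limit I i \<le> test_time I j + proc_time I j"
        using pcp_weight_le[OF True] mem before by simp
      moreover have "contrib I S i j + contrib I S j i = upper_limit I i + test_time I j"
        using True before by (simp add: contribs preds_antisym)
      ultimately show ?thesis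
        using untested_bounds(2)[OF i t] tested_bounds(2)[OF j] by simp
    next
      case False
      then have after: "?P (Exec_Tested j) (Exec_Untested i)" using preds_total mem by fastforce
      have "test_time I j + proc_time I j \<le> upper_limit I i"
        using pcp_weight_le[OF after] mem by simp
      moreover have "contrib I S i j + contrib I S j i = test_time I j + proc_time I j"
        using after before False by (simp add: contribs)
      ultimately show ?thesis
        using untested_bounds(1)[OF i] tested_bounds(3)[OF j] by simp
    qed
  qed
  then show ?thesis by (simp add: min_def)
qed

text \<open>With the test of \<open>i\<close> first, three orders remain: \<open>i\<close> finishes
  before \<open>j\<close> is tested, or both tests come first and then either execution. The test of
  \<open>i\<close> always delays \<open>j\<close>.\<close>

lemma delay_tested_tested:
  assumes i: "i < num_jobs I" "tested i" and j: "j < num_jobs I" "tested j" and ij: "i \<noteq> j"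
    and tests: "Test i \<in> preds (map snd S) (Test j)"
  shows "contrib I S i j + contrib I S j i \<le> R * min (opt_time I i) (opt_time I j)"
proof -
  let ?P = "\<lambda>k l. k \<in> preds (map snd S) l"
  have test: "?P (Test i) (Exec_Tested i)" "?P (Test j) (Exec_Tested j)"
    using pcp_test_first i j by blast+
  have mem: "Test i \<in> set (map snd S)" "Exec_Tested i \<in> set (map snd S)"
    "Test j \<in> set (map snd S)" "Exec_Tested j \<in> set (map snd S)"
    using pcp_set i j by auto
  have contribs:
    "contrib I S i j = test_time I i +
      (if ?P (Exec_Tested i) (Exec_Tested j) then proc_time I i else 0)"
    "contrib I S j i = (if ?P (Test j) (Exec_Tested i) then test_time I j else 0) +
      (if ?P (Exec_Tested j) (Exec_Tested i) then proc_time I j else 0)"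
    using i j ij preds_trans[OF tests test(2)] by (auto simp: contrib_tested pcp_final_task)
  have "contrib I S i j + contrib I S j i \<le> R * opt_time I i \<and>
      contrib I S i j + contrib I S j i \<le> R * opt_time I j"
  proof (cases "?P (Exec_Tested i) (Test j)")
    case True
    then have "test_time I i + proc_time I i \<le> \<beta> * test_time I j"
      using pcp_weight_le[OF True] mem by simp
    moreover have "contrib I S i j + contrib I S j i = test_time I i + proc_time I i"
      using True preds_trans[OF True test(2)] by (simp add: contribs preds_antisym)
    ultimately show ?thesis
      using tested_bounds(3)[OF i] tested_bounds(1)[OF j] by simp
  next
    case False
    then have before: "?P (Test j) (Exec_Tested i)" using preds_total mem by fastforce
    show ?thesis
    proof (cases "?P (Exec_Tested i) (Exec_Tested j)")
      case True
      \<comment> \<open>The wasted test of \<open>j\<close> is short because it was preferred to the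
        execution of \<open>i\<close>; this is the only use of the bound from
        \<open>R2\<close>.\<close>
      have "test_time I j \<le> (test_time I i + proc_time I i) / \<beta>"
        using pcp_weight_le[OF before] mem tests \<beta> by (simp add: field_simps)
      moreover have "test_time I i + proc_time I i \<le> test_time I j + proc_time I j"
        using pcp_weight_le[OF True] mem before by simp
      moreover have "contrib I S i j + contrib I S j i =
          test_time I i + proc_time I i + test_time I j"
        using True before by (simp add: contribs preds_antisym)
      ultimately show ?thesis
        using tested_bounds(4)[OF i] tested_bounds(2)[OF j] by simp
    next
      case False
      then have after: "?P (Exec_Tested j) (Exec_Tested i)"
        using preds_total mem ij by fastforce
      \<comment> \<open>The delay t_i + t_j + p_j is at most 2 t_i + p_i since the execution of
        \<open>j\<close> is the lighter one, and at most 2 t_j + p_j since t_i \<le> t_j.\<close>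
      have "test_time I i \<le> test_time I j"
        using pcp_weight_le[OF tests] mem \<beta> by simp
      moreover have "test_time I j + proc_time I j \<le> test_time I i + proc_time I i"
        using pcp_weight_le[OF after] mem preds_trans[OF tests test(2)] by simp
      moreover have "contrib I S i j + contrib I S j i =
          test_time I i + test_time I j + proc_time I j"
        using after before False by (simp add: contribs)
      ultimately show ?thesis
        using tested_bounds(2)[OF i] tested_bounds(2)[OF j] by simp
    qed
  qed
  then show ?thesis by (simp add: min_def)
qed

text \<open>The delay lemmas fix which job comes first or which is tested; symmetry of both sides
  covers the remaining cases.\<close>

lemma contrib_le_pair_bound:
  assumes i: "i < num_jobs I" and j: "j < num_jobs I"
  shows "contrib I S i j + contrib I S j i \<le> R * pair_bound I i j"
proof (cases "i = j")
  case True
  have "contrib I S i i \<le> R * opt_time I i"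
  proof (cases "tested i")
    case True
    then show ?thesis
      using tested_bounds(3)[OF i] pcp_done_tasks[OF _ i] pcp_set(3)[of i] nonneg[OF i]
      by (auto simp: contrib_eq)
  next
    case False
    then show ?thesis
      using untested_bounds(1)[OF i] pcp_done_tasks[OF _ i] pcp_set(1,2)[of i] nonneg[OF i]
      by (auto simp: contrib_eq)
  qed
  then show ?thesis using True by (simp add: pair_bound_def)
next
  case False
  have "contrib I S i j + contrib I S j i \<le> R * min (opt_time I i) (opt_time I j)"
  proof (cases "tested i"; cases "tested j")
    assume t: "tested i" "tested j"
    then have "Test i \<in> preds (map snd S) (Test j) \<or> Test j \<in> preds (map snd S) (Test i)"
      using i j False pcp_set(1) by (intro preds_total) auto
    then show ?thesis
      using delay_tested_tested[OF i t(1) j t(2) False]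
        delay_tested_tested[OF j t(2) i t(1) False[symmetric]]
      by (auto simp: min.commute add.commute)
  next
    assume t: "tested i" "\<not> tested j"
    then show ?thesis
      using delay_untested_tested[OF j t(2) i t(1)] by (simp add: min.commute add.commute)
  next
    assume t: "\<not> tested i" "tested j"
    then show ?thesis using delay_untested_tested[OF i t(1) j t(2)] by simp
  next
    assume t: "\<not> tested i" "\<not> tested j"
    then have "Exec_Untested i \<in> preds (map snd S) (Exec_Untested j) \<or>
        Exec_Untested j \<in> preds (map snd S) (Exec_Untested i)"
      using i j False pcp_set(3) by (intro preds_total) auto
    then show ?thesis
      using delay_untested_untested[OF i j t] delay_untested_untested[OF j i t(2,1)]
      by (auto simp: min.commute add.commute)
  qed
  then show ?thesis using False by (simp add: pair_bound_def)
qed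

section \<open>Summing over all pairs\<close>

lemma pcp_cost_le: "cost I S \<le> R * opt_cost I"
proof -
  define L where "L = (\<Sum>i<num_jobs I. \<Sum>j<num_jobs I. pair_bound I i j)"
  \<comment> \<open>The pairwise lower bound holds for every feasible schedule and so passes to the
    infimum, which is over a nonempty set because the PCP run itself is feasible.\<close>
  have "L / 2 \<le> opt_cost I"
    unfolding opt_cost_def
  proof (rule cINF_greatest)
    show "{S. feasible I S} \<noteq> {}" using pcp_feasible by blast
    show "L / 2 \<le> cost I S'" if "S' \<in> {S. feasible I S}" for S'
      using cost_ge_pair_bounds[OF valid, of S'] that by (simp add: L_def)
  qed
  then have "R * L / 2 \<le> R * opt_cost I"
    using mult_left_mono[of "L / 2" "opt_cost I" R] R4 by simp
  moreover have "2 * cost I S \<le> R * L"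
    unfolding pcp_cost L_def sum_distrib_left
    by (intro sum_mono contrib_le_pair_bound) auto
  ultimately show ?thesis by simp
qed

end

end

theorem theorem7:
  fixes \<alpha> \<beta> :: real
  assumes "\<alpha> \<ge> 1" and "\<beta> \<ge> 1"
  shows "competitive_ratio (pcp \<alpha> \<beta>) \<le>
    ereal (Max {\<alpha> * (1 + 1 / \<beta>), 1 + 1 / \<alpha> + 1 / \<beta> + 1 / (\<alpha> * \<beta>), \<beta>, 2, 1 + 2 / \<alpha>})"
    (is "_ \<le> ereal (Max ?A)")
proof -
  have R: "x \<le> Max ?A" if "x \<in> ?A" for x
    using that by (intro Max_ge) auto
  \<comment> \<open>The second term of the maximum is needed in factored form, for
    \<open>R2\<close>.\<close>
  have "(1 + 1 / \<alpha>) * (1 + 1 / \<beta>) = 1 + 1 / \<alpha> + 1 / \<beta> + 1 / (\<alpha> * \<beta>)"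
    by (simp add: algebra_simps)
  also have "\<dots> \<le> Max ?A" by (rule R) blast
  finally have prod: "(1 + 1 / \<alpha>) * (1 + 1 / \<beta>) \<le> Max ?A" .
  have "cost I S \<le> Max ?A * opt_cost I" if "valid_instance I" "S \<in> pcp \<alpha> \<beta> I" for I S
    by (rule pcp_cost_le[OF that assms R prod R R R]) blast+
  then have "competitive (pcp \<alpha> \<beta>) (Max ?A)"
    unfolding competitive_def by blast
  then show ?thesis
    unfolding competitive_ratio_def by (intro Inf_lower imageI CollectI)
qed

end
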